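(* Let $S$ be a left invertible LA-semigroup with left identity $e$. Then the following conditions are equivalent: (i) $S$ is intra-regular; (ii) $R\cap L=RL$ for every right ideal $R$ and every left ideal $L$ of $S$.
   Context: An LA-semigroup (left almost semigroup) is a nonempty set $S$ with a binary operation, written as juxtaposition, satisfying the left invertive law $(ab)c=(cb)a$ for all $a,b,c\in S$ (associativity and commutativity are not assumed). A left identity is an element $e\in S$ with $ea=a$ for all $a\in S$. An LA-semigroup $S$ with left identity $e$ is left invertible if for every $a\in S$ there exists $x\in S$ with $xa=e$. For subsets $A,B\subseteq S$, $AB=\{ab: a\in A,\ b\in B\}$. A nonempty subset $A\subseteq S$ is a left (right) ideal if $SA\subseteq A$ ($AS\subseteq A$). $S$ is intra-regular if for every $a\in S$ there exist $x,y\in S$ such that $a=(xa^{2})y$, where $a^2=aa$. *)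

theory Defs
  imports Main
begin

locale la_semigroup =
  fixes S :: "'a set" and mult :: "'a \<Rightarrow> 'a \<Rightarrow> 'a" (infixl "\<cdot>" 70)
  assumes nonempty: "S \<noteq> {}"
    and closed: "\<lbrakk>a \<in> S; b \<in> S\<rbrakk> \<Longrightarrow> a \<cdot> b \<in> S"
    and left_invertive: "\<lbrakk>a \<in> S; b \<in> S; c \<in> S\<rbrakk> \<Longrightarrow> (a \<cdot> b) \<cdot> c = (c \<cdot> b) \<cdot> a"

definition left_identity :: "'a set \<Rightarrow> ('a \<Rightarrow> 'a \<Rightarrow> 'a) \<Rightarrow> 'a \<Rightarrow> bool" where
  "left_identity S mult e \<longleftrightarrow> e \<in> S \<and> (\<forall>a\<in>S. mult e a = a)"

definition left_invertible :: "'a set \<Rightarrow> ('a \<Rightarrow> 'a \<Rightarrow> 'a) \<Rightarrow> 'a \<Rightarrow> bool" where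
  "left_invertible S mult e \<longleftrightarrow> (\<forall>a\<in>S. \<exists>x\<in>S. mult x a = e)"

definition set_product :: "('a \<Rightarrow> 'a \<Rightarrow> 'a) \<Rightarrow> 'a set \<Rightarrow> 'a set \<Rightarrow> 'a set" where
  "set_product mult A B = {mult a b | a b. a \<in> A \<and> b \<in> B}"

definition left_ideal :: "'a set \<Rightarrow> ('a \<Rightarrow> 'a \<Rightarrow> 'a) \<Rightarrow> 'a set \<Rightarrow> bool" where
  "left_ideal S mult A \<longleftrightarrow> A \<noteq> {} \<and> A \<subseteq> S \<and> set_product mult S A \<subseteq> A"

definition right_ideal :: "'a set \<Rightarrow> ('a \<Rightarrow> 'a \<Rightarrow> 'a) \<Rightarrow> 'a set \<Rightarrow> bool" where
  "right_ideal S mult A \<longleftrightarrow> A \<noteq> {} \<and> A \<subseteq> S \<and> set_product mult A S \<subseteq> A"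

definition intra_regular :: "'a set \<Rightarrow> ('a \<Rightarrow> 'a \<Rightarrow> 'a) \<Rightarrow> bool" where
  "intra_regular S mult \<longleftrightarrow>
     (\<forall>a\<in>S. \<exists>x\<in>S. \<exists>y\<in>S. a = mult (mult x (mult a a)) y)"

end

theory Submission imports Defs begin

text \<open>
  Left inverses make the semigroup so rigid that both conditions of the theorem always hold, and
  the equivalence is one between two true statements. Every one-sided ideal \<open>A\<close> is all of \<open>S\<close>:
  multiplying some \<open>a \<in> A\<close> by an inverse of \<open>a\<close> gives \<open>e \<in> A\<close>, and \<open>e\<close> generates \<open>S\<close> from either
  side. The ideal condition therefore reduces to \<open>S = SS\<close>, which follows from \<open>s = es\<close>.
  Intra-regularity holds because \<open>x\<close> can be taken to be a left inverse of \<open>a\<^sup>2\<close>, so that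
  \<open>(xa\<^sup>2)a = ea = a\<close>.
\<close>

text \<open>
  The left invertive law swaps the two factors at the price of a factor \<open>e\<close>:
  \<open>ax = (ea)x = (xa)e\<close>. This is what lets right ideals reach \<open>e\<close>.
\<close>
lemma left_inverse_is_right_inverse:
  assumes "la_semigroup S mult" and "left_identity S mult e"
    and "x \<in> S" and "a \<in> S" and "mult x a = e"
  shows "mult a x = e"
proof -
  interpret la_semigroup S mult by fact
  have e: "e \<in> S" "mult e b = b" if "b \<in> S" for b
    using assms(2) that by (auto simp: left_identity_def)
  have "mult a x = mult (mult e a) x" using assms(4) by (simp add: e)
  also have "\<dots> = mult (mult x a) e" using assms(3,4) e(1) by (intro left_invertive) auto
  also have "\<dots> = e" using assms(4,5) e by simp
  finally show ?thesis .
qed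

text \<open>
  Although \<open>e\<close> need not be a right identity, right multiplication by \<open>e\<close> is an involution by the
  left invertive law: \<open>(se)e = (ee)s = s\<close>. Hence every \<open>s\<close> is a left multiple of \<open>e\<close>, and a left
  ideal is everything once it contains \<open>e\<close>.
\<close>
lemma left_ideal_eq_carrier:
  assumes "la_semigroup S mult" and "left_identity S mult e" and "left_invertible S mult e"
    and "left_ideal S mult L"
  shows "L = S"
proof
  interpret la_semigroup S mult by fact
  have e: "e \<in> S" "\<And>b. b \<in> S \<Longrightarrow> mult e b = b"
    using assms(2) by (auto simp: left_identity_def)
  have absorb: "mult s l \<in> L" if "s \<in> S" "l \<in> L" for s l
    using assms(4) that by (auto simp: left_ideal_def set_product_def)
  show "L \<subseteq> S" using assms(4) by (simp add: left_ideal_def)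
  obtain a where a: "a \<in> L" "a \<in> S" using assms(4) by (auto simp: left_ideal_def)
  obtain x where "x \<in> S" "mult x a = e"
    using assms(3) a(2) by (auto simp: left_invertible_def)
  then have "e \<in> L" using absorb a(1) by metis
  show "S \<subseteq> L"
  proof
    fix s assume s: "s \<in> S"
    have "mult (mult s e) e = s" using left_invertive[of s e e] s e by simp
    moreover have "mult (mult s e) e \<in> L" using s e(1) \<open>e \<in> L\<close> by (intro absorb closed)
    ultimately show "s \<in> L" by simp
  qed
qed

lemma right_ideal_eq_carrier:
  assumes "la_semigroup S mult" and "left_identity S mult e" and "left_invertible S mult e"
    and "right_ideal S mult R"
  shows "R = S"
proof
  have absorb: "mult r s \<in> R" if "r \<in> R" "s \<in> S" for r s
    using assms(4) that by (auto simp: right_ideal_def set_product_def)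
  show "R \<subseteq> S" using assms(4) by (simp add: right_ideal_def)
  obtain a where a: "a \<in> R" "a \<in> S" using assms(4) by (auto simp: right_ideal_def)
  obtain x where x: "x \<in> S" "mult x a = e"
    using assms(3) a(2) by (auto simp: left_invertible_def)
  have "mult a x = e"
    using left_inverse_is_right_inverse[OF assms(1,2) x(1) a(2) x(2)] .
  then have "e \<in> R" using absorb a(1) x(1) by metis
  then show "S \<subseteq> R" using absorb assms(2) by (metis left_identity_def subsetI)
qed

lemma set_product_carrier:
  assumes "la_semigroup S mult" and "left_identity S mult e"
  shows "set_product mult S S = S"
proof
  show "set_product mult S S \<subseteq> S"
    using la_semigroup.closed[OF assms(1)] by (auto simp: set_product_def)
  show "S \<subseteq> set_product mult S S"
    using assms(2) by (force simp: set_product_def left_identity_def)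
qed

lemma left_invertible_imp_intra_regular:
  assumes "la_semigroup S mult" and "left_identity S mult e" and "left_invertible S mult e"
  shows "intra_regular S mult"
  unfolding intra_regular_def
proof
  fix a assume a: "a \<in> S"
  then have "mult a a \<in> S" by (intro la_semigroup.closed[OF assms(1)])
  then obtain x where "x \<in> S" "mult x (mult a a) = e"
    using assms(3) by (auto simp: left_invertible_def)
  moreover have "mult e a = a" using assms(2) a by (simp add: left_identity_def)
  ultimately show "\<exists>x\<in>S. \<exists>y\<in>S. a = mult (mult x (mult a a)) y" using a by metis
qed

theorem theorem6:
  fixes S :: "'a set" and mult :: "'a \<Rightarrow> 'a \<Rightarrow> 'a" and e :: 'a
  assumes "la_semigroup S mult"
    and "left_identity S mult e"
    and "left_invertible S mult e"
  shows "intra_regular S mult \<longleftrightarrow>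
    (\<forall>R L. right_ideal S mult R \<longrightarrow> left_ideal S mult L \<longrightarrow> R \<inter> L = set_product mult R L)"
proof -
  have "R \<inter> L = set_product mult R L" if "right_ideal S mult R" "left_ideal S mult L" for R L
    using right_ideal_eq_carrier[OF assms that(1)] left_ideal_eq_carrier[OF assms that(2)]
      set_product_carrier[OF assms(1,2)] by simp
  then show ?thesis using left_invertible_imp_intra_regular[OF assms] by blast
qed

end
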